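(* Let $0<q<p$ and let $a$ be a real number. Then $$L_{p,q}\{\cosh_{p,q}(at)\}(s)=\frac{p^2s}{(ps)^2-a^2},\qquad s>\left|\frac ap\right|,$$ $$L_{p,q}\{\sinh_{p,q}(at)\}(s)=\frac{pa}{(ps)^2-a^2},\qquad s>\left|\frac ap\right|.$$
   Context: Let $0<q<p$ be real numbers. For an integer $n\ge 0$, $[n]_{p,q}=\frac{p^n-q^n}{p-q}$, $[n]_{p,q}!=\prod_{k=1}^n[k]_{p,q}$ for $n\ge1$, $[0]_{p,q}!=1$. The $(p,q)$-exponentials are $e_{p,q}(z)=\sum_{n=0}^\infty\frac{p^{\binom n2}}{[n]_{p,q}!}z^n$ and $E_{p,q}(z)=\sum_{n=0}^\infty\frac{q^{\binom n2}}{[n]_{p,q}!}z^n$. The hyperbolic $(p,q)$-functions are $\cosh_{p,q}(z)=\frac{e_{p,q}(z)+e_{p,q}(-z)}2=\sum_{n=0}^\infty\frac{p^{\binom{2n}{2}}}{[2n]_{p,q}!}z^{2n}$ and $\sinh_{p,q}(z)=\frac{e_{p,q}(z)-e_{p,q}(-z)}2=\sum_{n=0}^\infty\frac{p^{\binom{2n+1}{2}}}{[2n+1]_{p,q}!}z^{2n+1}$. The improper $(p,q)$-integral of $f$ on $[0,\infty)$ is $\int_0^\infty f(x)\,d_{p,q}x=(p-q)\sum_{j=-\infty}^{\infty}\frac{q^j}{p^{j+1}}f\!\left(\frac{q^j}{p^{j+1}}\right)$. The $(p,q)$-Laplace transform of the first kind of a function $f(t)$ is $L_{p,q}\{f(t)\}(s)=\int_0^\infty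 f(t)E_{p,q}(-qts)\,d_{p,q}t$, $s>0$.
   Formalization: Each formula is asserted only when the transform exists (each node term is meaningful or has weight E(-qts)=0, and the sum converges); convergence is assumed, not proved. Without this it fails: for p=2, q=1, a=0, s=3 the cosh transform diverges. *)

theory Defs
  imports "HOL-Analysis.Analysis"
begin

definition pq_bracket :: "real \<Rightarrow> real \<Rightarrow> nat \<Rightarrow> real" where
  "pq_bracket p q n = (p ^ n - q ^ n) / (p - q)"

definition pq_fact :: "real \<Rightarrow> real \<Rightarrow> nat \<Rightarrow> real" where
  "pq_fact p q n = (\<Prod>k=1..n. pq_bracket p q k)"

definition pq_exp_term :: "real \<Rightarrow> real \<Rightarrow> real \<Rightarrow> nat \<Rightarrow> real" where
  "pq_exp_term p q z n = p ^ (n choose 2) / pq_fact p q n * z ^ n"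

definition pq_exp :: "real \<Rightarrow> real \<Rightarrow> real \<Rightarrow> real" where
  "pq_exp p q z = (\<Sum>n. pq_exp_term p q z n)"

definition pq_Exp :: "real \<Rightarrow> real \<Rightarrow> real \<Rightarrow> real" where
  "pq_Exp p q z = (\<Sum>n. q ^ (n choose 2) / pq_fact p q n * z ^ n)"

definition pq_cosh :: "real \<Rightarrow> real \<Rightarrow> real \<Rightarrow> real" where
  "pq_cosh p q z = (pq_exp p q z + pq_exp p q (- z)) / 2"

definition pq_sinh :: "real \<Rightarrow> real \<Rightarrow> real \<Rightarrow> real" where
  "pq_sinh p q z = (pq_exp p q z - pq_exp p q (- z)) / 2"

text \<open>
  For \<open>0 < q < p\<close> the series of \<^const>\<open>pq_exp\<close> has radius of convergence
  \<open>p / (p - q)\<close>, so \<^const>\<open>pq_cosh\<close> and \<^const>\<open>pq_sinh\<close> are only partially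
  defined. The following set is their domain of definition; outside of it
  the values of the total HOL functions carry no meaning.
\<close>

definition pq_hyp_dom :: "real \<Rightarrow> real \<Rightarrow> real set" where
  "pq_hyp_dom p q = {z. summable (pq_exp_term p q z) \<and> summable (pq_exp_term p q (- z))}"

definition pq_node :: "real \<Rightarrow> real \<Rightarrow> int \<Rightarrow> real" where
  "pq_node p q j = q powi j / p powi (j + 1)"

definition pq_integral :: "real \<Rightarrow> real \<Rightarrow> (real \<Rightarrow> real) \<Rightarrow> real" where
  "pq_integral p q f = (p - q) * (\<Sum>\<^sub>\<infinity>j\<in>UNIV. pq_node p q j * f (pq_node p q j))"

definition pq_laplace :: "real \<Rightarrow> real \<Rightarrow> (real \<Rightarrow> real) \<Rightarrow> real \<Rightarrow> real" where
  "pq_laplace p q f s = pq_integral p q (\<lambda>t. f t * pq_Exp p q (- q * t * s))"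

text \<open>
  \<open>pq_laplace_defined p q D f s\<close>: the transform at \<open>s\<close> of a function \<open>f\<close> with
  domain of definition \<open>D\<close> exists. Every term of the bilateral series has to be
  meaningful, and the series has to converge. A term whose weight
  \<open>pq_Exp p q (- q * t * s)\<close> vanishes counts as zero, even if its node \<open>t\<close> is
  not in \<open>D\<close>. Without this convention the transform of
  \<open>t \<mapsto> pq_cosh p q (a * t)\<close> would exist for no \<open>a \<noteq> 0\<close>, because the nodes
  are unbounded.
\<close>

definition pq_laplace_defined ::
    "real \<Rightarrow> real \<Rightarrow> real set \<Rightarrow> (real \<Rightarrow> real) \<Rightarrow> real \<Rightarrow> bool" where
  "pq_laplace_defined p q D f s \<longleftrightarrow>
     (\<forall>j. pq_node p q j \<in> D \<or> pq_Exp p q (- q * pq_node p q j * s) = 0) \<and>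
     (\<lambda>j. pq_node p q j * (f (pq_node p q j) * pq_Exp p q (- q * pq_node p q j * s)))
       summable_on UNIV"

end

theory Submission
  imports Defs
begin

text \<open>
  Write \<open>t\<^sub>j\<close> for the nodes, \<open>V\<^sub>j = E(-q t\<^sub>j s)\<close> and \<open>W\<^sub>j = e(a t\<^sub>j)\<close>. The \<open>(p,q)\<close>-difference
  equations of the two exponentials become \<open>V\<^bsub>j-1\<^esub> = (1 - (p-q) s t\<^sub>j) V\<^sub>j\<close> and
  \<open>W\<^bsub>j+1\<^esub> = (1 - (p-q) (a/p) t\<^sub>j) W\<^sub>j\<close>, so \<open>(s - a/p) (p-q) t\<^sub>j V\<^sub>j W\<^sub>j\<close> is the increment of
  \<open>V\<^bsub>j-1\<^esub> W\<^sub>j\<close>, which tends to \<open>1\<close> as \<open>j \<rightarrow> \<infinity>\<close>. Except for \<open>sinh\<close> with \<open>a = 0\<close>, the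
  transform can only exist if some \<open>V\<^sub>j\<close> vanishes, which forces \<open>(p-q) s t\<^sub>m = 1\<close> for some \<open>m\<close>; then \<open>V\<^sub>j = 0\<close> for all \<open>j < m\<close>, and the
  series telescopes to \<open>1 / (s - a/p)\<close>. Even and odd parts in \<open>a\<close> give the two formulas.
\<close>

section \<open>Coefficients and power series common to both exponentials\<close>

lemma pq_bracket_pos:
  assumes "0 < q" "q < p" "n > 0"
  shows "pq_bracket p q n > 0"
  using assms by (simp add: pq_bracket_def power_strict_mono)

lemma pq_fact_pos:
  assumes "0 < q" "q < p"
  shows "pq_fact p q n > 0"
  unfolding pq_fact_def using assms by (intro prod_pos) (auto intro: pq_bracket_pos)

lemma pq_fact_0 [simp]: "pq_fact p q 0 = 1"
  by (simp add: pq_fact_def)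

lemma pq_fact_Suc: "pq_fact p q (Suc n) = pq_fact p q n * pq_bracket p q (Suc n)"
  by (simp add: pq_fact_def)

lemma choose_two_0: "0 choose 2 = 0"
  by (simp add: numeral_2_eq_2)

lemma choose_two_Suc: "Suc n choose 2 = (n choose 2) + n"
  by (simp add: numeral_2_eq_2)

text \<open>With \<open>w = q\<close> these are the coefficients of \<open>pq_Exp\<close>, with
  \<open>w = p\<close> those of \<open>pq_exp\<close>, so one recursion serves both.\<close>

lemma pq_coeff_Suc:
  assumes "0 < q" "q < p"
  shows "w ^ (Suc n choose 2) / pq_fact p q (Suc n) * (p ^ Suc n - q ^ Suc n)
           = (p - q) * w ^ n * (w ^ (n choose 2) / pq_fact p q n)"
proof -
  have "pq_bracket p q (Suc n) > 0" using assms by (intro pq_bracket_pos) auto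
  moreover have "p ^ Suc n - q ^ Suc n = (p - q) * pq_bracket p q (Suc n)"
    using assms by (simp add: pq_bracket_def)
  ultimately show ?thesis
    using pq_fact_pos[OF assms, of n]
    by (simp only: pq_fact_Suc choose_two_Suc power_add) (simp add: field_simps)
qed

text \<open>Multiply \<open>rec\<close> by \<open>z ^ Suc n\<close> and sum over \<open>n\<close>;
  the constant terms cancel on the left. Convergence at \<open>p * z\<close> is enough, since
  neither \<open>q * z\<close> nor \<open>w * z\<close> is larger in absolute value.\<close>

lemma powser_difference_equation:
  fixes p q w z :: real and c :: "nat \<Rightarrow> real"
  assumes pq: "0 < q" "q < p" and w: "0 < w" "w \<le> p"
    and rec: "\<And>n. c (Suc n) * (p ^ Suc n - q ^ Suc n) = (p - q) * w ^ n * c n"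
    and sm: "summable (\<lambda>n. c n * (p * z) ^ n)"
  shows "(\<Sum>n. c n * (p * z) ^ n) - (\<Sum>n. c n * (q * z) ^ n)
           = (p - q) * z * (\<Sum>n. c n * (w * z) ^ n)"
proof (cases "z = 0")
  case False
  \<comment> \<open>\<open>powser_inside\<close> needs a strictly smaller argument, hence the split;
    \<open>pq_exp\<close> uses the boundary case \<open>w = p\<close>.\<close>
  have inside: "summable (\<lambda>n. c n * (v * z) ^ n)" if "0 < v" "v \<le> p" for v
  proof (cases "v = p")
    case False
    with that \<open>z \<noteq> 0\<close> pq have "norm (v * z) < norm (p * z)" by (simp add: abs_mult)
    from powser_inside[OF sm this] show ?thesis .
  qed (use sm in simp)
  have sw: "summable (\<lambda>n. c n * (w * z) ^ n)" by (rule inside[OF w])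
  have sq: "summable (\<lambda>n. c n * (q * z) ^ n)" using inside[of q] pq by simp
  have "(\<Sum>n. c n * (p * z) ^ n) - (\<Sum>n. c n * (q * z) ^ n)
          = (\<Sum>n. c n * (p * z) ^ n - c n * (q * z) ^ n)"
    by (rule suminf_diff[OF sm sq])
  also have "\<dots> = (\<Sum>n. c (Suc n) * (p * z) ^ Suc n - c (Suc n) * (q * z) ^ Suc n)"
    using suminf_split_head[OF summable_diff[OF sm sq]] by simp
  also have "\<dots> = (\<Sum>n. (p - q) * z * (c n * (w * z) ^ n))"
  proof (rule suminf_cong)
    fix n
    have "c (Suc n) * (p * z) ^ Suc n - c (Suc n) * (q * z) ^ Suc n
            = c (Suc n) * (p ^ Suc n - q ^ Suc n) * z ^ Suc n"
      by (simp only: power_mult_distrib) (simp add: algebra_simps)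
    also have "\<dots> = (p - q) * z * (c n * (w * z) ^ n)"
      unfolding rec by (simp add: power_mult_distrib)
    finally show "c (Suc n) * (p * z) ^ Suc n - c (Suc n) * (q * z) ^ Suc n
            = (p - q) * z * (c n * (w * z) ^ n)" .
  qed
  also have "\<dots> = (p - q) * z * (\<Sum>n. c n * (w * z) ^ n)"
    by (rule suminf_mult[OF sw])
  finally show ?thesis .
qed simp

lemma powser_tendsto_coeff_0:
  fixes c :: "nat \<Rightarrow> real"
  assumes "summable (\<lambda>n. c n * K ^ n)" "K \<noteq> 0" and x: "x \<longlonglongrightarrow> 0"
  shows "(\<lambda>i. \<Sum>n. c n * x i ^ n) \<longlonglongrightarrow> c 0"
proof -
  have "isCont (\<lambda>x. \<Sum>n. c n * x ^ n) 0"
    by (rule isCont_powser[OF assms(1)]) (use assms(2) in auto)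
  from isCont_tendsto_compose[OF this x] show ?thesis by simp
qed

section \<open>The entire exponential \<open>pq_Exp\<close>\<close>

lemma summable_pq_Exp:
  assumes "0 < q" "q < p"
  shows "summable (\<lambda>n. q ^ (n choose 2) / pq_fact p q n * z ^ n)"
proof -
  define c where "c n = q ^ (n choose 2) / pq_fact p q n" for n
  have nz: "c n > 0" for n
    using assms pq_fact_pos[OF assms, of n] by (simp add: c_def)
  have ratio: "c (Suc n) / c n = (p - q) * q ^ n / (p ^ Suc n - q ^ Suc n)" for n
  proof -
    have "p ^ Suc n - q ^ Suc n > 0"
      using assms power_strict_mono[of q p "Suc n"] by simp
    then show ?thesis
      using pq_coeff_Suc[OF assms, of q n] nz[of n] unfolding c_def[symmetric]
      by (simp add: field_simps)
  qed
  \<comment> \<open>The coefficient ratios are dominated by a null sequence, so the ratio test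
    succeeds for every \<open>z\<close>.\<close>
  have le: "c (Suc n) / c n \<le> (q / p) ^ n" for n
  proof -
    have pos: "p ^ Suc n - q ^ Suc n > 0"
      using assms power_strict_mono[of q p "Suc n"] by simp
    have "q * q ^ n \<le> q * p ^ n" using assms by (intro mult_left_mono power_mono) auto
    then have "(p - q) * p ^ n \<le> p ^ Suc n - q ^ Suc n" by (simp add: algebra_simps)
    then have "((p - q) * p ^ n) * q ^ n \<le> (p ^ Suc n - q ^ Suc n) * q ^ n"
      using assms by (intro mult_right_mono) auto
    then show ?thesis using pos assms
      unfolding ratio power_divide by (subst divide_le_eq) (simp_all add: field_simps)
  qed
  have lim: "(\<lambda>n. (q / p) ^ n * \<bar>z\<bar>) \<longlonglongrightarrow> 0"
    using assms by (intro tendsto_mult_left_zero LIMSEQ_realpow_zero) auto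
  then have "eventually (\<lambda>n. (q / p) ^ n * \<bar>z\<bar> < 1 / 2) sequentially"
    by (rule order_tendstoD) simp
  then obtain N where N: "\<And>n. n \<ge> N \<Longrightarrow> (q / p) ^ n * \<bar>z\<bar> < 1 / 2"
    by (auto simp: eventually_sequentially)
  have "summable (\<lambda>n. c n * z ^ n)"
  proof (rule summable_ratio_test[of "1 / 2" N])
    fix n assume n: "n \<ge> N"
    have "norm (c (Suc n) * z ^ Suc n) = (c (Suc n) / c n * \<bar>z\<bar>) * norm (c n * z ^ n)"
      using nz[of n] nz[of "Suc n"] by (simp add: abs_mult power_abs)
    also have "\<dots> \<le> 1 / 2 * norm (c n * z ^ n)"
    proof (rule mult_right_mono)
      have "c (Suc n) / c n * \<bar>z\<bar> \<le> (q / p) ^ n * \<bar>z\<bar>" by (intro mult_right_mono le) auto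
      then show "c (Suc n) / c n * \<bar>z\<bar> \<le> 1 / 2" using N[OF n] by linarith
    qed simp
    finally show "norm (c (Suc n) * z ^ Suc n) \<le> 1 / 2 * norm (c n * z ^ n)" .
  qed simp
  then show ?thesis by (simp add: c_def)
qed

lemma pq_Exp_difference_equation:
  assumes "0 < q" "q < p"
  shows "pq_Exp p q (p * z) = (1 + (p - q) * z) * pq_Exp p q (q * z)"
  using powser_difference_equation[OF assms, of q, OF _ _ pq_coeff_Suc[OF assms]
      summable_pq_Exp[OF assms], of z] assms
  unfolding pq_Exp_def[symmetric] by (simp add: algebra_simps)

lemma pq_Exp_tendsto_1:
  assumes "0 < q" "q < p" "x \<longlonglongrightarrow> 0"
  shows "(\<lambda>i. pq_Exp p q (x i)) \<longlonglongrightarrow> 1"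
  using powser_tendsto_coeff_0[OF summable_pq_Exp[OF assms(1,2), of 1] _ assms(3)]
  by (simp add: pq_Exp_def choose_two_0)

section \<open>The exponential \<open>pq_exp\<close> and its disc of convergence\<close>

lemma pq_exp_coeff_ratio:
  assumes "0 < q" "q < p"
  shows "pq_exp_term p q z (Suc n) * (p * (1 - (q / p) ^ Suc n))
           = (p - q) * z * pq_exp_term p q z n"
proof -
  \<comment> \<open>In this normalisation the factor increases to \<open>p\<close>, so the ratio of
    consecutive terms tends to \<open>(p - q) * z / p\<close>.\<close>
  have "p * (1 - (q / p) ^ Suc n) = (p ^ Suc n - q ^ Suc n) / p ^ n"
    using assms by (simp add: field_simps)
  then have "pq_exp_term p q z (Suc n) * (p * (1 - (q / p) ^ Suc n))
      = (p ^ (Suc n choose 2) / pq_fact p q (Suc n) * (p ^ Suc n - q ^ Suc n)) * z ^ Suc n / p ^ n"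
    by (simp only: pq_exp_term_def) (simp add: field_simps)
  also have "\<dots> = (p - q) * z * pq_exp_term p q z n"
    unfolding pq_coeff_Suc[OF assms] using assms by (simp add: pq_exp_term_def)
  finally show ?thesis .
qed

lemma summable_pq_exp:
  assumes pq: "0 < q" "q < p" and z: "(p - q) * \<bar>z\<bar> < p"
  shows "summable (pq_exp_term p q z)"
proof -
  define y where "y = (p - q) * \<bar>z\<bar> / p"
  have y: "0 \<le> y" "y < 1" using assms by (auto simp: y_def)
  \<comment> \<open>\<open>y\<close> is the limit of the ratios in absolute value; \<open>b\<close>
    leaves room for approaching it from above.\<close>
  obtain b where b: "y < b" "b < 1" using dense[OF y(2)] by blast
  have "(\<lambda>n. b * (1 - (q / p) ^ Suc n)) \<longlonglongrightarrow> b * (1 - 0)"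
    using pq by (intro tendsto_intros LIMSEQ_Suc[OF LIMSEQ_realpow_zero]) auto
  then have "eventually (\<lambda>n. b * (1 - (q / p) ^ Suc n) > y) sequentially"
    by (rule order_tendstoD) (use b in simp)
  then obtain N where N: "\<And>n. n \<ge> N \<Longrightarrow> b * (1 - (q / p) ^ Suc n) > y"
    by (auto simp: eventually_sequentially)
  show ?thesis
  proof (rule summable_ratio_test[of b N])
    fix n assume "n \<ge> N"
    define d where "d = 1 - (q / p) ^ Suc n"
    define u where "u = \<bar>pq_exp_term p q z n\<bar>"
    have d: "d > 0" unfolding d_def using pq power_Suc_less_one[of "q / p" n] by simp
    have "\<bar>pq_exp_term p q z (Suc n)\<bar> * (p * d) = (p - q) * \<bar>z\<bar> * u"
      using arg_cong[OF pq_exp_coeff_ratio[OF pq, of z n], of abs] pq d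
      unfolding d_def[symmetric] u_def by (simp add: abs_mult)
    then have "\<bar>pq_exp_term p q z (Suc n)\<bar> * d = y * u"
      using pq by (simp add: y_def field_simps)
    also have "\<dots> \<le> (b * d) * u"
      using N[OF \<open>n \<ge> N\<close>] by (intro mult_right_mono) (auto simp: d_def u_def)
    finally have "\<bar>pq_exp_term p q z (Suc n)\<bar> * d \<le> (b * u) * d" by (simp add: mult_ac)
    then show "norm (pq_exp_term p q z (Suc n)) \<le> b * norm (pq_exp_term p q z n)"
      using d by (simp add: u_def)
  qed (rule b)
qed

text \<open>On and outside the circle of convergence the terms never decrease in absolute value and
  start at 1, so they cannot tend to 0.\<close>

lemma summable_pq_exp_imp_bound:
  assumes pq: "0 < q" "q < p" and sm: "summable (pq_exp_term p q z)"
  shows "(p - q) * \<bar>z\<bar> < p"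
proof (rule ccontr)
  assume "\<not> ?thesis"
  then have z: "(p - q) * \<bar>z\<bar> \<ge> p" by simp
  have "\<bar>pq_exp_term p q z n\<bar> \<ge> 1" for n
  proof (induction n)
    case (Suc n)
    define d where "d = 1 - (q / p) ^ Suc n"
    have d: "0 < d" "d \<le> 1" unfolding d_def using pq power_Suc_less_one[of "q / p" n] by simp_all
    have "\<bar>pq_exp_term p q z (Suc n)\<bar> * (p * d) = (p - q) * \<bar>z\<bar> * \<bar>pq_exp_term p q z n\<bar>"
      using arg_cong[OF pq_exp_coeff_ratio[OF pq, of z n], of abs] pq d
      unfolding d_def[symmetric] by (simp add: abs_mult)
    also have "\<dots> \<ge> p * 1" using z Suc pq by (intro mult_mono) auto
    finally have "p * 1 \<le> p * (\<bar>pq_exp_term p q z (Suc n)\<bar> * d)" by (simp add: mult_ac)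
    then have "1 \<le> \<bar>pq_exp_term p q z (Suc n)\<bar> * d"
      using pq by (subst (asm) mult_le_cancel_left_pos) auto
    also have "\<dots> \<le> \<bar>pq_exp_term p q z (Suc n)\<bar> * 1" using d by (intro mult_left_mono) auto
    finally show ?case by simp
  qed (simp add: pq_exp_term_def choose_two_0)
  moreover have "(\<lambda>n. \<bar>pq_exp_term p q z n\<bar>) \<longlonglongrightarrow> 0"
    using summable_LIMSEQ_zero[OF sm] by (rule tendsto_rabs_zero)
  then have "eventually (\<lambda>n. \<bar>pq_exp_term p q z n\<bar> < 1) sequentially"
    by (rule order_tendstoD) simp
  ultimately show False by (auto simp: eventually_sequentially not_less[symmetric])
qed

text \<open>The bound on \<open>z\<close> says exactly that \<open>p * z\<close> lies in the open
  disc of convergence.\<close>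

lemma pq_exp_difference_equation:
  assumes "0 < q" "q < p" "(p - q) * \<bar>z\<bar> < 1"
  shows "pq_exp p q (q * z) = (1 - (p - q) * z) * pq_exp p q (p * z)"
proof -
  have "summable (pq_exp_term p q (p * z))"
    by (rule summable_pq_exp[OF assms(1,2)]) (use assms in \<open>simp add: abs_mult\<close>)
  then have sm: "summable (\<lambda>n. p ^ (n choose 2) / pq_fact p q n * (p * z) ^ n)"
    by (simp add: pq_exp_term_def[abs_def])
  show ?thesis
    using powser_difference_equation[OF assms(1,2), of p, OF _ _ pq_coeff_Suc[OF assms(1,2)] sm]
      assms
    by (simp add: pq_exp_def pq_exp_term_def[abs_def] algebra_simps)
qed

lemma pq_exp_tendsto_1:
  assumes "0 < q" "q < p" "x \<longlonglongrightarrow> 0"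
  shows "(\<lambda>i. pq_exp p q (x i)) \<longlonglongrightarrow> 1"
proof -
  have "summable (pq_exp_term p q 1)"
    by (rule summable_pq_exp[OF assms(1,2)]) (use assms in simp)
  then have "summable (\<lambda>n. p ^ (n choose 2) / pq_fact p q n * 1 ^ n)"
    by (simp add: pq_exp_term_def[abs_def])
  from powser_tendsto_coeff_0[OF this _ assms(3)] show ?thesis
    by (simp add: pq_exp_def pq_exp_term_def choose_two_0)
qed

section \<open>The geometric sequence of nodes\<close>

lemma pq_node_pos:
  assumes "0 < q" "q < p"
  shows "pq_node p q j > 0"
  using assms by (simp add: pq_node_def)

text \<open>This form matches the arguments \<open>p * z\<close> and \<open>q * z\<close> of the
  difference equations.\<close>

lemma pq_node_succ:
  assumes "0 < q" "q < p"
  shows "p * pq_node p q (j + 1) = q * pq_node p q j"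
  using assms by (simp add: pq_node_def power_int_add power2_eq_square mult_ac)

lemma pq_node_add_nat:
  assumes "0 < q" "q < p"
  shows "pq_node p q (m + int i) = pq_node p q m * (q / p) ^ i"
  using assms by (simp add: pq_node_def power_int_add power_divide)

lemma pq_node_diff_nat:
  assumes "0 < q" "q < p"
  shows "pq_node p q (m - int i) = pq_node p q m * (p / q) ^ i"
  using assms by (simp add: pq_node_def power_int_add power_int_diff power_divide)

lemma pq_node_tendsto_0:
  assumes "0 < q" "q < p"
  shows "(\<lambda>i. pq_node p q (m + int i)) \<longlonglongrightarrow> 0"
  unfolding pq_node_add_nat[OF assms]
  using assms by (intro tendsto_mult_right_zero LIMSEQ_realpow_zero) auto

lemma pq_node_unbounded:
  assumes "0 < q" "q < p"
  shows "\<exists>i. B < pq_node p q (m - int i)"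
proof -
  have "1 < p / q" using assms by simp
  then obtain i where "B / pq_node p q m < (p / q) ^ i" using real_arch_pow by blast
  then have "B < pq_node p q (m - int i)"
    using pq_node_pos[OF assms, of m]
    by (simp add: pq_node_diff_nat[OF assms] pos_divide_less_eq mult.commute)
  then show ?thesis ..
qed

section \<open>The weights at the nodes and where they vanish\<close>

context
  fixes p q s :: real
  assumes pq: "0 < q" "q < p" and s: "0 < s"
begin

definition weight :: "int \<Rightarrow> real" where
  "weight j = pq_Exp p q (- q * pq_node p q j * s)"

lemma weight_pred: "weight (j - 1) = (1 - (p - q) * s * pq_node p q j) * weight j"
proof -
  have "q * pq_node p q (j - 1) = p * pq_node p q j"
    using pq_node_succ[OF pq, of "j - 1"] by simp
  then have "weight (j - 1) = pq_Exp p q (p * (- pq_node p q j * s))"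
    by (simp add: weight_def mult.assoc)
  then show ?thesis
    unfolding pq_Exp_difference_equation[OF pq] by (simp add: weight_def mult_ac)
qed

lemma weight_tendsto_1: "(\<lambda>i. weight (m + int i)) \<longlonglongrightarrow> 1"
proof -
  have "(\<lambda>i. - q * pq_node p q (m + int i) * s) \<longlonglongrightarrow> - q * 0 * s"
    by (intro tendsto_intros pq_node_tendsto_0[OF pq])
  then show ?thesis
    unfolding weight_def by (intro pq_Exp_tendsto_1[OF pq]) simp
qed

text \<open>If no factor in \<open>weight_pred\<close> vanished, a zero at \<open>j\<close> would
  propagate to all larger indices, against the limit 1.\<close>

lemma weight_zero_imp_node:
  assumes "weight j = 0"
  obtains m where "(p - q) * s * pq_node p q m = 1"
proof -
  have "\<exists>m. (p - q) * s * pq_node p q m = 1"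
  proof (rule ccontr)
    assume no: "\<nexists>m. (p - q) * s * pq_node p q m = 1"
    have "weight (j + int i) = 0" for i
    proof (induction i)
      case (Suc i)
      have "(p - q) * s * pq_node p q (j + int (Suc i)) \<noteq> 1" using no by blast
      then show ?case
        using weight_pred[of "j + int (Suc i)"] Suc by (simp add: add.commute)
    qed (use assms in simp)
    then show False using weight_tendsto_1[of j] LIMSEQ_unique[OF tendsto_const] by fastforce
  qed
  then show ?thesis using that by blast
qed

text \<open>The vanishing factor at \<open>m\<close> kills the weight at \<open>m - 1\<close>, and
  \<open>weight_pred\<close> carries the zero downwards. This makes the bilateral series
  one-sided.\<close>

lemma weight_below_zero:
  assumes "(p - q) * s * pq_node p q m = 1" "j < m"
  shows "weight j = 0"
proof -
  have "weight (m - 1 - int i) = 0" for i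
  proof (induction i)
    case 0
    show ?case using weight_pred[of m] assms by simp
  next
    case (Suc i)
    show ?case using weight_pred[of "m - 1 - int i"] Suc by (simp add: algebra_simps)
  qed
  from this[of "nat (m - 1 - j)"] show ?thesis using assms(2) by simp
qed

text \<open>
  As \<open>j\<close> decreases the nonzero terms eventually grow, so they cannot be summable.
\<close>

lemma weight_zero_if_summable:
  assumes "(\<lambda>j. pq_node p q j * weight j) summable_on UNIV"
  shows "\<exists>j. weight j = 0"
proof (rule ccontr)
  assume nz: "\<nexists>j. weight j = 0"
  define u where "u j = pq_node p q j * weight j" for j
  \<comment> \<open>Beyond this threshold \<open>(p - q) * s * pq_node p q j > 2\<close>, so the
    factor in \<open>weight_pred\<close> exceeds 1 in absolute value.\<close>
  obtain k where k: "2 / ((p - q) * s) < pq_node p q (0 - int k)"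
    using pq_node_unbounded[OF pq] by blast
  define v where "v i = \<bar>u (- int k - int i)\<bar>" for i
  have mono: "v i \<le> v (Suc i)" for i
  proof -
    define j where "j = - int k - int i"
    have j1: "- int k - int (Suc i) = j - 1" by (simp add: j_def)
    have "pq_node p q (0 - int k) * 1 \<le> pq_node p q (0 - int k) * (p / q) ^ i"
      using pq pq_node_pos[OF pq] by (intro mult_left_mono one_le_power) (auto intro: less_imp_le)
    then have "2 / ((p - q) * s) < pq_node p q j"
      using k pq_node_diff_nat[OF pq, of "- int k" i] by (simp add: j_def)
    then have "2 < (p - q) * s * pq_node p q j"
      using pq s by (simp add: pos_divide_less_eq mult_ac)
    then have "\<bar>weight (j - 1)\<bar> \<ge> 1 * \<bar>weight j\<bar>"
      unfolding weight_pred abs_mult by (intro mult_right_mono) auto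
    moreover have "pq_node p q j \<le> pq_node p q (j - 1)"
    proof -
      have "q * pq_node p q (j - 1) = p * pq_node p q j"
        using pq_node_succ[OF pq, of "j - 1"] by simp
      moreover have "p * pq_node p q j \<ge> q * pq_node p q j"
        using pq pq_node_pos[OF pq, of j] by (intro mult_right_mono) auto
      ultimately show ?thesis using pq by (metis mult_le_cancel_left_pos)
    qed
    ultimately have "pq_node p q j * \<bar>weight j\<bar> \<le> pq_node p q (j - 1) * \<bar>weight (j - 1)\<bar>"
      using pq_node_pos[OF pq, of "j - 1"] by (intro mult_mono) auto
    then show ?thesis
      using pq_node_pos[OF pq, of j] pq_node_pos[OF pq, of "j - 1"]
      unfolding v_def j1 unfolding j_def[symmetric] by (simp add: u_def abs_mult)
  qed
  have "inj (\<lambda>i. - int k - int i)" by (auto simp: inj_def)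
  moreover have "u summable_on range (\<lambda>i. - int k - int i)"
    using assms by (auto simp: u_def[abs_def] intro: summable_on_subset)
  ultimately have "(u \<circ> (\<lambda>i. - int k - int i)) summable_on UNIV"
    by (subst (asm) summable_on_reindex) auto
  then have "summable (\<lambda>i. u (- int k - int i))"
    using summable_on_imp_summable by (fastforce simp: o_def)
  then have "v \<longlonglongrightarrow> 0"
    unfolding v_def by (intro tendsto_rabs_zero summable_LIMSEQ_zero)
  \<comment> \<open>A nondecreasing null sequence has \<open>v 0 \<le> 0\<close>, but
    \<open>v 0\<close> is the absolute value of a nonzero term.\<close>
  moreover have "v 0 \<le> v i" for i by (induction i) (use mono order_trans in auto)
  ultimately have "v 0 \<le> 0" by (intro LIMSEQ_le_const) auto
  then show False
    using nz pq_node_pos[OF pq, of "- int k"] by (simp add: v_def u_def)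
qed

section \<open>Summation of the one-sided series by telescoping\<close>

lemma pq_exp_laplace_sums:
  assumes m: "(p - q) * s * pq_node p q m = 1" and a: "\<bar>a / p\<bar> < s"
  shows "(\<lambda>i. (p - q) * (pq_node p q (m + int i) *
            (pq_exp p q (a * pq_node p q (m + int i)) * weight (m + int i)))) sums (p / (p * s - a))"
proof -
  define t where "t i = pq_node p q (m + int i)" for i
  define W where "W i = pq_exp p q (a * t i)" for i
  \<comment> \<open>The weight lags one index behind, so that \<open>T 0\<close> contains the
    vanishing weight at \<open>m - 1\<close>.\<close>
  define T where "T i = weight (m + int i - 1) * W i" for i
  have sa: "s - a / p > 0" using a by linarith
  have t_pos: "t i > 0" for i using pq_node_pos[OF pq] by (simp add: t_def)
  have t_le: "t i \<le> t 0" for i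
    using pq pq_node_pos[OF pq, of m]
    by (simp add: t_def pq_node_add_nat[OF pq] mult_left_le power_le_one)
  have W_Suc: "W (Suc i) = (1 - (p - q) * (a / p) * t i) * W i" for i
  proof -
    \<comment> \<open>Chosen so that \<open>p * z\<close> and \<open>q * z\<close> are the arguments
      of \<open>W i\<close> and \<open>W (Suc i)\<close>.\<close>
    define z where "z = a * t i / p"
    have pt: "p * t (Suc i) = q * t i"
      using pq_node_succ[OF pq, of "m + int i"] by (simp add: t_def add.assoc add.commute[of 1])
    have "(p - q) * \<bar>z\<bar> = \<bar>a / p\<bar> * ((p - q) * t i)"
      using t_pos[of i] pq by (simp add: z_def abs_mult)
    also have "\<dots> \<le> \<bar>a / p\<bar> * ((p - q) * t 0)"
      using t_le[of i] pq by (intro mult_left_mono) auto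
    \<comment> \<open>Here the bound on \<open>s\<close> keeps every \<open>a * t i\<close> inside
      the disc: \<open>t 0\<close> is the largest node, and \<open>m\<close> fixes its
      value.\<close>
    also have "\<dots> < s * ((p - q) * t 0)"
      using a pq t_pos[of 0] by (intro mult_strict_right_mono) auto
    also have "\<dots> = 1" using m by (simp add: t_def mult_ac)
    finally have "pq_exp p q (q * z) = (1 - (p - q) * z) * pq_exp p q (p * z)"
      by (rule pq_exp_difference_equation[OF pq])
    moreover have "q * z = a * t (Suc i)" using pt pq by (simp add: z_def field_simps)
    moreover have "p * z = a * t i" using pq by (simp add: z_def)
    ultimately show ?thesis by (simp add: W_def z_def mult_ac)
  qed
  have step: "T (Suc i) - T i = (s - a / p) * ((p - q) * (t i * (W i * weight (m + int i))))" for i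
  proof -
    have "T (Suc i) = weight (m + int i) * W (Suc i)" by (simp add: T_def algebra_simps)
    moreover have "T i = (1 - (p - q) * s * t i) * weight (m + int i) * W i"
      by (simp add: T_def weight_pred t_def)
    \<comment> \<open>To be read with \<open>b = a / p\<close>, \<open>x = t i\<close>,
      \<open>w = W i\<close> and \<open>v\<close> the weight at \<open>m + int i\<close>.\<close>
    moreover have "v * ((1 - (p - q) * b * x) * w) - (1 - (p - q) * s * x) * v * w
                     = (s - b) * ((p - q) * (x * (w * v)))" for v b x w :: real
      by (simp add: algebra_simps)
    ultimately show ?thesis unfolding W_Suc by metis
  qed
  have "(\<lambda>i. a * t i) \<longlonglongrightarrow> 0"
    unfolding t_def by (intro tendsto_mult_right_zero pq_node_tendsto_0[OF pq])
  then have "W \<longlonglongrightarrow> 1" unfolding W_def by (rule pq_exp_tendsto_1[OF pq])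
  moreover have "(\<lambda>i. weight (m + int i - 1)) \<longlonglongrightarrow> 1"
    using weight_tendsto_1[of "m - 1"] by (simp add: algebra_simps)
  ultimately have "T \<longlonglongrightarrow> 1 * 1" unfolding T_def by (intro tendsto_mult)
  then have "(\<lambda>i. T (Suc i) - T i) sums (1 - T 0)" by (intro telescope_sums) simp
  moreover have "T 0 = 0" using weight_below_zero[OF m] by (simp add: T_def)
  ultimately have "(\<lambda>i. (s - a / p) * ((p - q) * (t i * (W i * weight (m + int i))))) sums 1"
    by (simp add: step)
  from sums_divide[OF this, of "s - a / p"] sa
  have "(\<lambda>i. (p - q) * (t i * (W i * weight (m + int i)))) sums (1 / (s - a / p))" by simp
  moreover have "1 / (s - a / p) = p / (p * s - a)" using sa pq by (simp add: field_simps)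
  ultimately show ?thesis by (simp add: t_def W_def)
qed

section \<open>From the bilateral unordered sum to an ordinary series\<close>

lemma pq_laplace_eq_suminf:
  assumes m: "(p - q) * s * pq_node p q m = 1"
    and sm: "(\<lambda>j. pq_node p q j * (f (pq_node p q j) * weight j)) summable_on UNIV"
  shows "pq_laplace p q f s =
    (\<Sum>i. (p - q) * (pq_node p q (m + int i) * (f (pq_node p q (m + int i)) * weight (m + int i))))"
proof -
  define u where "u j = pq_node p q j * (f (pq_node p q j) * weight j)" for j
  have img: "range (\<lambda>i. m + int i) = {m..}"
  proof (intro equalityI subsetI)
    fix j assume "j \<in> {m..}"
    then have "j = m + int (nat (j - m))" by simp
    then show "j \<in> range (\<lambda>i. m + int i)" by blast
  qed auto
  have inj: "inj (\<lambda>i. m + int i)" by (auto simp: inj_def)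
  have "(u has_sum infsum u UNIV) UNIV" using sm by (simp add: u_def[abs_def])
  moreover have "u j = 0" if "j \<notin> {m..}" for j
    using weight_below_zero[OF m, of j] that by (simp add: u_def)
  \<comment> \<open>Dropping the zero terms below \<open>m\<close> does not change the sum.\<close>
  ultimately have "(u has_sum infsum u UNIV) (range (\<lambda>i. m + int i))"
    unfolding img by (subst has_sum_cong_neutral[where T = UNIV and g = u]) auto
  then have "((u \<circ> (\<lambda>i. m + int i)) has_sum infsum u UNIV) UNIV"
    by (subst (asm) has_sum_reindex[OF inj])
  then have "(\<lambda>i. u (m + int i)) sums infsum u UNIV"
    using has_sum_imp_sums by (fastforce simp: o_def)
  then have "(\<lambda>i. (p - q) * u (m + int i)) sums ((p - q) * infsum u UNIV)" by (rule sums_mult)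
  moreover have "pq_laplace p q f s = (p - q) * infsum u UNIV"
    by (simp add: pq_laplace_def pq_integral_def u_def[abs_def] weight_def)
  ultimately show ?thesis by (simp add: u_def sums_iff)
qed

text \<open>The nodes are unbounded, so some \<open>a * pq_node p q j\<close> leaves the disc of
  convergence; existence of the transform then forces the weight there to be 0.\<close>

lemma pq_laplace_defined_imp_node:
  assumes def: "pq_laplace_defined p q {t. a * t \<in> pq_hyp_dom p q} f s" and a: "a \<noteq> 0"
  obtains m where "(p - q) * s * pq_node p q m = 1"
proof -
  obtain i where "p / ((p - q) * \<bar>a\<bar>) < pq_node p q (0 - int i)"
    using pq_node_unbounded[OF pq] by blast
  then have "p < (p - q) * \<bar>a * pq_node p q (0 - int i)\<bar>"
    using pq a pq_node_pos[OF pq, of "0 - int i"]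
    by (simp add: pos_divide_less_eq abs_mult mult_ac)
  then have "a * pq_node p q (0 - int i) \<notin> pq_hyp_dom p q"
    using summable_pq_exp_imp_bound[OF pq] by (force simp: pq_hyp_dom_def)
  then have "weight (0 - int i) = 0"
    using def by (auto simp: pq_laplace_defined_def weight_def)
  then show ?thesis using weight_zero_imp_node that by blast
qed

section \<open>The transforms of \<open>pq_cosh\<close> and \<open>pq_sinh\<close>\<close>

lemma pq_laplace_cosh:
  assumes def: "pq_laplace_defined p q {t. a * t \<in> pq_hyp_dom p q} (\<lambda>t. pq_cosh p q (a * t)) s"
    and a: "\<bar>a / p\<bar> < s"
  shows "pq_laplace p q (\<lambda>t. pq_cosh p q (a * t)) s = (p / (p * s - a) + p / (p * s + a)) / 2"
proof -
  have sm: "(\<lambda>j. pq_node p q j * (pq_cosh p q (a * pq_node p q j) * weight j)) summable_on UNIV"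
    using def by (simp add: pq_laplace_defined_def weight_def)
  obtain m where m: "(p - q) * s * pq_node p q m = 1"
  \<comment> \<open>For \<open>a = 0\<close> every argument is 0 and no node leaves the domain; the
    function is constantly 1, and a zero weight comes from summability instead.\<close>
  proof (cases "a = 0")
    case True
    have "pq_exp p q 0 = 1"
      using pq_exp_tendsto_1[OF pq tendsto_const] LIMSEQ_unique[OF tendsto_const] by blast
    then have "(\<lambda>j. pq_node p q j * weight j) summable_on UNIV"
      using sm True by (simp add: pq_cosh_def)
    then show ?thesis using weight_zero_if_summable weight_zero_imp_node that by blast
  next
    case False
    from pq_laplace_defined_imp_node[OF def this] that show ?thesis by blast
  qed
  \<comment> \<open>The summand \<open>pq_exp p q (- a * t)\<close> contributes
    \<open>p / (p * s + a)\<close>.\<close>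
  have a': "\<bar>(- a) / p\<bar> < s" using a by simp
  show ?thesis
    unfolding pq_laplace_eq_suminf[OF m, where f = "\<lambda>t. pq_cosh p q (a * t)", OF sm]
    using sums_divide[OF sums_add[OF pq_exp_laplace_sums[OF m a] pq_exp_laplace_sums[OF m a']],
        of 2]
    by (intro sums_unique[symmetric]) (simp add: pq_cosh_def field_simps)
qed

lemma pq_laplace_sinh:
  assumes def: "pq_laplace_defined p q {t. a * t \<in> pq_hyp_dom p q} (\<lambda>t. pq_sinh p q (a * t)) s"
    and a: "\<bar>a / p\<bar> < s"
  shows "pq_laplace p q (\<lambda>t. pq_sinh p q (a * t)) s = (p / (p * s - a) - p / (p * s + a)) / 2"
proof (cases "a = 0")
  case True
  \<comment> \<open>Both sides are 0. No index \<open>m\<close> need exist here, since the zero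
    function is summable against any weights.\<close>
  then show ?thesis by (simp add: pq_laplace_def pq_integral_def pq_sinh_def)
next
  case False
  have sm: "(\<lambda>j. pq_node p q j * (pq_sinh p q (a * pq_node p q j) * weight j)) summable_on UNIV"
    using def by (simp add: pq_laplace_defined_def weight_def)
  obtain m where m: "(p - q) * s * pq_node p q m = 1"
    using pq_laplace_defined_imp_node[OF def False] by blast
  have a': "\<bar>(- a) / p\<bar> < s" using a by simp
  show ?thesis
    unfolding pq_laplace_eq_suminf[OF m, where f = "\<lambda>t. pq_sinh p q (a * t)", OF sm]
    using sums_divide[OF sums_diff[OF pq_exp_laplace_sums[OF m a] pq_exp_laplace_sums[OF m a']],
        of 2]
    by (intro sums_unique[symmetric]) (simp add: pq_sinh_def field_simps)
qed

end

theorem theorem3p8: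
  fixes p q a s :: real
  assumes "0 < q" "q < p"
    and "s > \<bar>a / p\<bar>"
  shows "(pq_laplace_defined p q {t. a * t \<in> pq_hyp_dom p q} (\<lambda>t. pq_cosh p q (a * t)) s \<longrightarrow>
            pq_laplace p q (\<lambda>t. pq_cosh p q (a * t)) s = p\<^sup>2 * s / ((p * s)\<^sup>2 - a\<^sup>2)) \<and>
         (pq_laplace_defined p q {t. a * t \<in> pq_hyp_dom p q} (\<lambda>t. pq_sinh p q (a * t)) s \<longrightarrow>
            pq_laplace p q (\<lambda>t. pq_sinh p q (a * t)) s = p * a / ((p * s)\<^sup>2 - a\<^sup>2))"
proof -
  have s: "0 < s" using assms(3) abs_ge_zero[of "a / p"] by linarith
  have "\<bar>a\<bar> < p * s" using assms by (simp add: abs_mult pos_divide_less_eq mult.commute)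
  \<comment> \<open>Nonzero denominators allow the two partial fractions to be combined.\<close>
  then have nz: "p * s - a \<noteq> 0" "p * s + a \<noteq> 0" by auto
  have sq: "(p * s)\<^sup>2 - a\<^sup>2 = (p * s - a) * (p * s + a)"
    by (simp add: power2_eq_square algebra_simps)
  have "p / (p * s - a) + p / (p * s + a) = 2 * (p\<^sup>2 * s) / ((p * s)\<^sup>2 - a\<^sup>2)"
    unfolding sq add_frac_eq[OF nz] by (simp add: power2_eq_square algebra_simps)
  then have even: "(p / (p * s - a) + p / (p * s + a)) / 2 = p\<^sup>2 * s / ((p * s)\<^sup>2 - a\<^sup>2)"
    by (metis nonzero_mult_div_cancel_left times_divide_eq_right zero_neq_numeral)
  have "p / (p * s - a) - p / (p * s + a) = 2 * (p * a) / ((p * s)\<^sup>2 - a\<^sup>2)"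
    unfolding sq diff_frac_eq[OF nz] by (simp add: algebra_simps)
  then have odd: "(p / (p * s - a) - p / (p * s + a)) / 2 = p * a / ((p * s)\<^sup>2 - a\<^sup>2)"
    by (metis nonzero_mult_div_cancel_left times_divide_eq_right zero_neq_numeral)
  show ?thesis
    using pq_laplace_cosh[OF assms(1,2) s _ assms(3)] pq_laplace_sinh[OF assms(1,2) s _ assms(3)]
    unfolding even odd by blast
qed

end
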